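(* For every integer $n\geqslant 0$, $$Q_2(n) = \sum_{k=0}^\infty \overline{p}\left(\frac{n-k(k+1)/2}{4} \right)$$ and $$b_4(n) = \sum_{k=0}^\infty \overline{p}\left(\frac{n-k(k+1)/2}{2} \right).$$
   Context: A partition of $n$ is a nonincreasing sequence of positive integers (called parts) with sum $n$; the empty partition is the only partition of $0$. $Q_2(n)$ is the number of partitions of $n$ into distinct parts none of which is congruent to $2$ modulo $4$. $b_4(n)$ is the number of $4$-regular partitions of $n$, i.e. partitions of $n$ with no part divisible by $4$. An overpartition of $n$ is a nonincreasing sequence of positive integers with sum $n$ in which the first occurrence of each number may be overlined; $\overline{p}(n)$ is the number of overpartitions of $n$, with $\overline{p}(0)=1$ and $\overline{p}(x)=0$ if $x$ is not a nonnegative integer (so the sums are finite). *)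

theory Defs
  imports Complex_Main
begin

definition partitions :: "nat \<Rightarrow> nat list set" where
  "partitions n = {xs. sorted_wrt (\<ge>) xs \<and> (\<forall>x\<in>set xs. 0 < x) \<and> sum_list xs = n}"

definition Q2 :: "nat \<Rightarrow> nat" where
  "Q2 n = card {xs \<in> partitions n. distinct xs \<and> (\<forall>x\<in>set xs. x mod 4 \<noteq> 2)}"

definition b4 :: "nat \<Rightarrow> nat" where
  "b4 n = card {xs \<in> partitions n. \<forall>x\<in>set xs. \<not> 4 dvd x}"

text \<open>A part of an overpartition is a pair of its size and a flag telling whether it is overlined;
  the last condition allows the flag only on the first occurrence of a size.\<close>

definition overpartitions :: "nat \<Rightarrow> (nat \<times> bool) list set" where
  "overpartitions n =
     {ps. map fst ps \<in> partitions n \<and>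
          (\<forall>i<length ps. snd (ps ! i) \<longrightarrow> (\<forall>j<i. fst (ps ! j) \<noteq> fst (ps ! i)))}"

definition pbar :: "rat \<Rightarrow> nat" where
  "pbar x = (if x \<in> \<nat> then card (overpartitions (nat \<lfloor>x\<rfloor>)) else 0)"

end

theory Submission
  imports Defs "HOL-Computational_Algebra.Formal_Laurent_Series"
begin

text \<open>
  Let \<open>q\<close> be a formal variable, and write \<open>E\<^sub>d\<close> for the product of all \<open>1 - q^(dm)\<close> and \<open>P\<^sub>d\<close> for the
  product of all \<open>1 + q^(dm)\<close>, \<open>m \<ge> 1\<close>, so that \<open>P\<^sub>d E\<^sub>d = E\<^sub>2\<^sub>d\<close>. Overpartitions have the
  generating function \<open>P\<^sub>1 / E\<^sub>1\<close>, since a part size contributes \<open>(1 + q^m) / (1 - q^m)\<close>. Hence the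
  two right-hand sides are the coefficients of \<open>\<psi> P\<^sub>4 / E\<^sub>4\<close> and \<open>\<psi> P\<^sub>2 / E\<^sub>2\<close>, where \<open>\<psi>\<close> is the
  sum of all \<open>q^(k(k+1)/2)\<close>. Gauss's identity \<open>\<psi> = P\<^sub>1 E\<^sub>2\<close> (lemma \<open>gauss_triangular\<close>) turns
  them into products:

  \<^item> \<open>P\<^sub>1 E\<^sub>2 P\<^sub>4 / E\<^sub>4 = P\<^sub>1 P\<^sub>4 / P\<^sub>2\<close>, and \<open>P\<^sub>2 / P\<^sub>4\<close> is the product of the factors \<open>1 + q^m\<close>
    with \<open>m\<close> congruent to 2 modulo 4; dividing them out of \<open>P\<^sub>1\<close> leaves the generating function
    of \<^const>\<open>Q2\<close>.
  \<^item> \<open>P\<^sub>1 E\<^sub>2 P\<^sub>2 / E\<^sub>2 = P\<^sub>1 P\<^sub>2 = E\<^sub>4 / E\<^sub>1\<close>, which is the generating function of \<^const>\<open>b4\<close>.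

  Only coefficients up to \<open>n\<close> matter, so all infinite products and sums are cut off at \<open>n\<close>, and
  equality is replaced by agreement of the coefficients up to \<open>n\<close> (\<open>fps_eq_upto\<close>).

  Gauss's identity is obtained from a polynomial identity that holds exactly for every \<open>n\<close>
  (lemma \<open>sum_gauss_term\<close>): with the Gaussian binomial coefficients,
  \<open>(\<Prod>m=1..n. 1 + q^m)^2 = (\<Sum>j\<le>n. [2n+1, n-j] q^(j(j+1)/2))\<close>. After multiplication by the product
  of all \<open>1 - q^m\<close>, \<open>m \<le> n\<close>, the \<open>j\<close>-th summand agrees with \<open>q^(j(j+1)/2)\<close> up to \<open>q^n\<close>.
\<close>

unbundle fps_syntax

section \<open>Counting partitions by the multiplicities of their parts\<close>

definition partitions_upto :: "nat \<Rightarrow> nat \<Rightarrow> nat list set" where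
  "partitions_upto M n = {xs \<in> partitions n. set xs \<subseteq> {1..M}}"

text \<open>
  The factor of a generating function that belongs to the part size \<open>m\<close>: multiplicity \<open>c\<close> has
  weight \<open>f c\<close> and contributes \<open>m * c\<close> to the sum of the parts.
\<close>

definition part_series :: "nat \<Rightarrow> (nat \<Rightarrow> 'a) \<Rightarrow> 'a :: comm_semiring_1 fps" where
  "part_series m f = Abs_fps (\<lambda>i. if m dvd i then f (i div m) else 0)"

lemma partitions_upto_eq_partitions:
  assumes "n \<le> M"
  shows "partitions_upto M n = partitions n"
proof -
  have "x \<le> M" if "x \<in> set xs" "sum_list xs = n" for x xs
    using member_le_sum_list[of x xs] that assms by simp
  then show ?thesis
    by (auto simp: partitions_upto_def partitions_def Suc_le_eq)
qed

lemma finite_partitions: "finite (partitions n)"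
proof -
  have "length xs \<le> sum_list xs" if "\<forall>x\<in>set xs. 0 < x" for xs :: "nat list"
    using that by (induction xs) auto
  then have "partitions n \<subseteq> {xs. set xs \<subseteq> {..n} \<and> length xs \<le> n}"
    using member_le_sum_list by (fastforce simp: partitions_def)
  then show ?thesis
    by (rule finite_subset) (simp add: finite_lists_length_le)
qed

lemma finite_partitions_upto: "finite (partitions_upto M n)"
  using finite_partitions by (simp add: partitions_upto_def)

lemma partitions_upto_0: "partitions_upto 0 n = (if n = 0 then {[]} else {})"
  by (auto simp: partitions_upto_def partitions_def)

lemma split_largest_part:
  fixes xs :: "nat list"
  assumes "sorted_wrt (\<ge>) xs" and "set xs \<subseteq> {..M}"
  shows "replicate (count_list xs M) M @ filter (\<lambda>x. x \<noteq> M) xs = xs"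
  using assms
proof (induction xs)
  case (Cons x xs)
  show ?case
  proof (cases "x = M")
    case True
    with Cons show ?thesis by simp
  next
    case False
    with Cons.prems have "M \<notin> set (x # xs)" by force
    then show ?thesis by (simp add: filter_id_conv) metis
  qed
qed simp

text \<open>
  Together with \<open>split_largest_part\<close> this sets up the recursion on the bound for the parts: the
  copies of \<open>Suc M\<close> form a prefix, and what follows is an arbitrary partition into parts up to \<open>M\<close>.
\<close>

lemma partitions_upto_Suc_iff:
  "replicate c (Suc M) @ ys \<in> partitions_upto (Suc M) n \<and> set ys \<subseteq> {..M}
     \<longleftrightarrow> c * Suc M \<le> n \<and> ys \<in> partitions_upto M (n - c * Suc M)"
proof (cases "set ys \<subseteq> {1..M}")
  case True
  define d where "d = c * Suc M"
  have "sorted_wrt (\<ge>) (replicate c a)" for a :: nat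
    by (induction c) auto
  then have sorted: "sorted_wrt (\<ge>) (replicate c (Suc M) @ ys) \<longleftrightarrow> sorted_wrt (\<ge>) ys"
    using True by (force simp: sorted_wrt_append)
  have sum: "sum_list (replicate c (Suc M) @ ys) = d + sum_list ys"
    by (simp add: sum_list_replicate d_def)
  have subset: "set (replicate c (Suc M) @ ys) \<subseteq> {1..Suc M}"
    using True by (auto simp: set_replicate_conv_if)
  then have pos: "\<forall>x\<in>set (replicate c (Suc M) @ ys). 0 < x"
    by fastforce
  have ys: "\<forall>x\<in>set ys. 0 < x" "set ys \<subseteq> {..M}"
    using True by fastforce+
  have "replicate c (Suc M) @ ys \<in> partitions_upto (Suc M) n \<longleftrightarrow>
      sorted_wrt (\<ge>) ys \<and> d + sum_list ys = n"
    by (simp only: partitions_upto_def partitions_def mem_Collect_eq sorted sum subset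
        pos[THEN eqTrueI] simp_thms)
  moreover have "ys \<in> partitions_upto M (n - d) \<longleftrightarrow> sorted_wrt (\<ge>) ys \<and> sum_list ys = n - d"
    by (simp only: partitions_upto_def partitions_def mem_Collect_eq True
        ys(1)[THEN eqTrueI] simp_thms)
  ultimately show ?thesis
    using ys(2) unfolding d_def[symmetric] by auto
next
  case False
  then have "\<not> (set ys \<subseteq> {1..Suc M} \<and> set ys \<subseteq> {..M})" by fastforce
  with False show ?thesis
    by (simp add: partitions_upto_def del: mult_Suc_right mult_Suc)
qed

lemma sum_partitions_upto_Suc:
  fixes F :: "nat list \<Rightarrow> 'a :: comm_monoid_add"
  shows "sum F (partitions_upto (Suc M) n) =
     (\<Sum>i | i \<le> n \<and> Suc M dvd i.
        \<Sum>ys\<in>partitions_upto M (n - i). F (replicate (i div Suc M) (Suc M) @ ys))"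
proof -
  let ?split = "\<lambda>xs. (count_list xs (Suc M) * Suc M, filter (\<lambda>x. x \<noteq> Suc M) xs)"
  let ?join = "\<lambda>(i, ys). replicate (i div Suc M) (Suc M) @ ys"
  let ?S = "SIGMA i : {i. i \<le> n \<and> Suc M dvd i}. partitions_upto M (n - i)"
  have join_split: "?join (?split xs) = xs"
    and split_mem: "?split xs \<in> ?S" if xs: "xs \<in> partitions_upto (Suc M) n" for xs
  proof -
    have eq: "replicate (count_list xs (Suc M)) (Suc M) @ filter (\<lambda>x. x \<noteq> Suc M) xs = xs"
      using xs by (intro split_largest_part) (auto simp: partitions_upto_def partitions_def)
    show "?join (?split xs) = xs"
      using eq by (simp del: mult_Suc_right)
    have "set (filter (\<lambda>x. x \<noteq> Suc M) xs) \<subseteq> {..M}"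
      using xs by (auto simp: partitions_upto_def le_Suc_eq)
    then show "?split xs \<in> ?S"
      using partitions_upto_Suc_iff[of "count_list xs (Suc M)" M "filter (\<lambda>x. x \<noteq> Suc M) xs" n]
        eq xs by (simp del: mult_Suc_right)
  qed
  have join_mem: "?join p \<in> partitions_upto (Suc M) n" and split_join: "?split (?join p) = p"
    if p: "p \<in> ?S" for p
  proof -
    obtain c ys where p': "p = (c * Suc M, ys)" "c * Suc M \<le> n" "ys \<in> partitions_upto M (n - c * Suc M)"
      using p by (auto elim!: dvdE simp: mult.commute simp del: mult_Suc mult_Suc_right)
    then have ys: "set ys \<subseteq> {..M}" and mem: "replicate c (Suc M) @ ys \<in> partitions_upto (Suc M) n"
      using partitions_upto_Suc_iff[of c M ys n] by auto
    show "?join p \<in> partitions_upto (Suc M) n"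
      using mem p'(1) by (simp del: mult_Suc_right)
    have "Suc M \<notin> set ys" using ys by auto
    moreover have "count_list (replicate c (Suc M)) (Suc M) = c" by (induction c) auto
    moreover have "filter (\<lambda>x. x \<noteq> Suc M) ys = ys" using ys by (auto simp: filter_id_conv)
    ultimately show "?split (?join p) = p"
      using p'(1) by (simp del: mult_Suc_right)
  qed
  have "sum F (partitions_upto (Suc M) n) = (\<Sum>p\<in>?S. F (?join p))"
    by (rule sum.reindex_bij_witness[where i = ?join and j = ?split])
       (use join_split split_mem join_mem split_join in \<open>auto simp del: mult_Suc_right\<close>)
  also have "\<dots> = (\<Sum>(i, ys)\<in>?S. F (replicate (i div Suc M) (Suc M) @ ys))"
    by (simp add: case_prod_unfold)
  also have "\<dots> = (\<Sum>i | i \<le> n \<and> Suc M dvd i.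
        \<Sum>ys\<in>partitions_upto M (n - i). F (replicate (i div Suc M) (Suc M) @ ys))"
    by (rule sum.Sigma[symmetric]) (simp_all add: finite_partitions_upto)
  finally show ?thesis .
qed

text \<open>
  The generating function of any weight that is a product over the part sizes of a factor depending
  on the multiplicity alone. It serves for \<^const>\<open>Q2\<close> and \<^const>\<open>b4\<close>, where the weights are
  0 and 1, and for overpartitions, where a size that occurs at all has weight 2. The induction on
  \<open>M\<close> works because splitting off the copies of the largest part is the Cauchy product with the
  factor of that part.
\<close>

lemma sum_partitions_upto_eq_coeff:
  fixes w :: "nat \<Rightarrow> nat \<Rightarrow> 'a :: comm_semiring_1"
  shows "(\<Sum>xs\<in>partitions_upto M n. \<Prod>m=1..M. w m (count_list xs m)) =
         (\<Prod>m=1..M. part_series m (w m)) $ n"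
proof (induction M arbitrary: n)
  case 0
  show ?case by (simp add: partitions_upto_0)
next
  case (Suc M)
  have weight: "(\<Prod>m=1..Suc M. w m (count_list (replicate c (Suc M) @ ys) m)) =
        w (Suc M) c * (\<Prod>m=1..M. w m (count_list ys m))"
    if "ys \<in> partitions_upto M k" for c ys k
  proof -
    have "count_list (replicate c (Suc M)) m = (if m = Suc M then c else 0)" for m
      by (induction c) auto
    moreover have "count_list ys (Suc M) = 0"
      using that by (force simp: partitions_upto_def count_list_0_iff)
    ultimately show ?thesis by (simp add: prod.nat_ivl_Suc' mult.commute)
  qed
  have "(\<Sum>xs\<in>partitions_upto (Suc M) n. \<Prod>m=1..Suc M. w m (count_list xs m)) =
        (\<Sum>i | i \<le> n \<and> Suc M dvd i.
           w (Suc M) (i div Suc M) * (\<Prod>m=1..M. part_series m (w m)) $ (n - i))"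
    unfolding sum_partitions_upto_Suc
  proof (intro sum.cong refl)
    fix i
    show "(\<Sum>ys\<in>partitions_upto M (n - i).
             \<Prod>m=1..Suc M. w m (count_list (replicate (i div Suc M) (Suc M) @ ys) m)) =
          w (Suc M) (i div Suc M) * (\<Prod>m=1..M. part_series m (w m)) $ (n - i)"
      unfolding Suc.IH[symmetric] sum_distrib_left by (intro sum.cong refl weight)
  qed
  also have "\<dots> = (\<Sum>i=0..n. part_series (Suc M) (w (Suc M)) $ i *
                     (\<Prod>m=1..M. part_series m (w m)) $ (n - i))"
    by (rule sum.mono_neutral_cong_left) (auto simp: part_series_def)
  also have "\<dots> = (part_series (Suc M) (w (Suc M)) * (\<Prod>m=1..M. part_series m (w m))) $ n"
    by (simp only: fps_mult_nth)
  also have "part_series (Suc M) (w (Suc M)) * (\<Prod>m=1..M. part_series m (w m)) =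
      (\<Prod>m=1..Suc M. part_series m (w m))"
    by (simp add: mult.commute)
  finally show ?case .
qed

section \<open>Overpartitions of a given shape\<close>

lemma card_first_occurrences:
  "card {i. i < length xs \<and> (\<forall>j<i. xs ! j \<noteq> xs ! i)} = card (set xs)"
proof -
  let ?I = "{i. i < length xs \<and> (\<forall>j<i. xs ! j \<noteq> xs ! i)}"
  have "inj_on (\<lambda>i. xs ! i) ?I"
    by (rule inj_onI) (metis (mono_tags, lifting) linorder_neqE_nat mem_Collect_eq)
  moreover have "(\<lambda>i. xs ! i) ` ?I = set xs"
  proof
    show "set xs \<subseteq> (\<lambda>i. xs ! i) ` ?I"
    proof
      fix x assume "x \<in> set xs"
      then obtain i where i: "i < length xs" "xs ! i = x" by (auto simp: in_set_conv_nth)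
      define k where "k = (LEAST k. xs ! k = x)"
      have "xs ! k = x" unfolding k_def by (rule LeastI) (rule i)
      moreover have "k \<le> i" unfolding k_def by (rule Least_le) (rule i)
      moreover have "xs ! j \<noteq> x" if "j < k" for j
        using that not_less_Least unfolding k_def by blast
      ultimately show "x \<in> (\<lambda>i. xs ! i) ` ?I" using i by (intro image_eqI[of _ _ k]) auto
    qed
  qed auto
  ultimately show ?thesis using card_image by fastforce
qed

lemma card_flaggings:
  assumes "I \<subseteq> {..<length xs}"
  shows "card {ps. map fst ps = xs \<and> (\<forall>i<length ps. snd (ps ! i) \<longrightarrow> i \<in> I)} = 2 ^ card I"
proof -
  let ?flag = "\<lambda>J. map (\<lambda>i. (xs ! i, i \<in> J)) [0..<length xs]"
  have "bij_betw ?flag (Pow I) {ps. map fst ps = xs \<and> (\<forall>i<length ps. snd (ps ! i) \<longrightarrow> i \<in> I)}"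
  proof (rule bij_betw_byWitness[where f' = "\<lambda>ps. {i. i < length ps \<and> snd (ps ! i)}"])
    show "\<forall>ps\<in>{ps. map fst ps = xs \<and> (\<forall>i<length ps. snd (ps ! i) \<longrightarrow> i \<in> I)}.
        ?flag {i. i < length ps \<and> snd (ps ! i)} = ps"
      by (auto intro!: nth_equalityI prod_eqI)
    show "\<forall>J\<in>Pow I. {i. i < length (?flag J) \<and> snd (?flag J ! i)} = J"
      using assms by auto
    show "?flag ` Pow I \<subseteq> {ps. map fst ps = xs \<and> (\<forall>i<length ps. snd (ps ! i) \<longrightarrow> i \<in> I)}"
      by (auto intro!: nth_equalityI)
  qed auto
  from bij_betw_same_card[OF this] show ?thesis
    using card_Pow[of I] assms finite_subset[of I "{..<length xs}"] by simp
qed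

text \<open>
  A partition with \<open>k\<close> different part sizes has \<open>k\<close> positions that may carry an overline, one for
  each size, and any set of them may be chosen.
\<close>

lemma card_overpartitions: "card (overpartitions n) = (\<Sum>xs\<in>partitions n. 2 ^ card (set xs))"
proof -
  let ?fib = "\<lambda>xs. {ps. map fst ps = xs \<and> 
      (\<forall>i<length ps. snd (ps ! i) \<longrightarrow> i \<in> {i. i < length xs \<and> (\<forall>j<i. xs ! j \<noteq> xs ! i)})}"
  have card: "card (?fib xs) = 2 ^ card (set xs)" for xs
    by (subst card_flaggings) (auto simp: card_first_occurrences)
  then have fin: "finite (?fib xs)" for xs
    by (intro card_ge_0_finite) (subst card, simp)
  have "overpartitions n = (\<Union>xs\<in>partitions n. ?fib xs)"
    by (auto simp: overpartitions_def)
  then have "card (overpartitions n) = (\<Sum>xs\<in>partitions n. card (?fib xs))"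
    using finite_partitions fin by (simp only:) (rule card_UN_disjoint; auto)
  then show ?thesis by (simp only: card)
qed

section \<open>Power series that agree up to a given degree\<close>

definition fps_eq_upto :: "nat \<Rightarrow> 'a :: zero fps \<Rightarrow> 'a fps \<Rightarrow> bool" where
  "fps_eq_upto n f g \<longleftrightarrow> (\<forall>k\<le>n. f $ k = g $ k)"

lemma fps_eq_upto_refl [simp]: "fps_eq_upto n f f"
  by (simp add: fps_eq_upto_def)

lemma fps_eq_upto_sym: "fps_eq_upto n f g \<Longrightarrow> fps_eq_upto n g f"
  by (simp add: fps_eq_upto_def)

lemma fps_eq_upto_trans [trans]:
  "fps_eq_upto n f g \<Longrightarrow> fps_eq_upto n g h \<Longrightarrow> fps_eq_upto n f h"
  by (simp add: fps_eq_upto_def)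

lemma fps_eq_upto_mult:
  fixes f g f' g' :: "'a :: comm_semiring_1 fps"
  assumes "fps_eq_upto n f g" and "fps_eq_upto n f' g'"
  shows "fps_eq_upto n (f * f') (g * g')"
  using assms by (auto simp: fps_eq_upto_def fps_mult_nth intro!: sum.cong)

lemma fps_eq_upto_sum:
  fixes f g :: "'b \<Rightarrow> 'a :: comm_monoid_add fps"
  assumes "\<And>i. i \<in> A \<Longrightarrow> fps_eq_upto n (f i) (g i)"
  shows "fps_eq_upto n (sum f A) (sum g A)"
  using assms by (auto simp: fps_eq_upto_def fps_sum_nth intro!: sum.cong)

lemma fps_eq_upto_cancel:
  fixes f g h :: "'a :: field fps"
  assumes "fps_eq_upto n (h * f) (h * g)" and "h $ 0 \<noteq> 0"
  shows "fps_eq_upto n f g"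
proof -
  have "fps_eq_upto n (inverse h * (h * f)) (inverse h * (h * g))"
    using assms(1) by (rule fps_eq_upto_mult[OF fps_eq_upto_refl])
  moreover have "inverse h * (h * k) = k" for k
    using inverse_mult_eq_1[OF assms(2)] by (simp flip: mult.assoc)
  ultimately show ?thesis by (simp only:)
qed

text \<open>
  A factor \<open>X^t\<close> improves the precision by \<open>t\<close>.
\<close>

lemma fps_eq_upto_X_power_mult:
  fixes f g :: "'a :: comm_ring_1 fps"
  assumes "fps_eq_upto k f g" and "n \<le> k + t"
  shows "fps_eq_upto n (fps_X ^ t * f) (fps_X ^ t * g)"
  using assms by (auto simp: fps_eq_upto_def fps_X_power_mult_nth)

text \<open>
  The constant \<open>c\<close> is there to cover both \<open>1 + X^m\<close> and \<open>1 - X^m\<close>.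
\<close>

lemma prod_eq_upto_1:
  fixes c :: "'a :: comm_ring_1 fps"
  assumes "\<And>m. m \<in> A \<Longrightarrow> n < m"
  shows "fps_eq_upto n (\<Prod>m\<in>A. 1 + c * fps_X ^ m) 1"
  using assms
proof (induction A rule: infinite_finite_induct)
  case (insert m A)
  have "fps_eq_upto n (1 + c * fps_X ^ m) 1"
    using insert.prems[of m] by (auto simp: fps_eq_upto_def fps_X_power_mult_right_nth)
  with insert show ?case
    using fps_eq_upto_mult[of n "1 + c * fps_X ^ m" 1 "\<Prod>m\<in>A. 1 + c * fps_X ^ m" 1] by simp
qed auto

lemma prod_eq_upto:
  fixes c :: "'a :: comm_ring_1 fps"
  assumes "finite A" and "finite B" and "A \<inter> {..n} = B \<inter> {..n}"
  shows "fps_eq_upto n (\<Prod>m\<in>A. 1 + c * fps_X ^ m) (\<Prod>m\<in>B. 1 + c * fps_X ^ m)"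
proof -
  have cut: "fps_eq_upto n (\<Prod>m\<in>A. 1 + c * fps_X ^ m) (\<Prod>m\<in>A \<inter> {..n}. 1 + c * fps_X ^ m)"
    if "finite A" for A
  proof -
    have "(\<Prod>m\<in>A. 1 + c * fps_X ^ m) =
        (\<Prod>m\<in>A \<inter> {..n}. 1 + c * fps_X ^ m) * (\<Prod>m\<in>A - {..n}. 1 + c * fps_X ^ m)"
      using that by (rule prod.Int_Diff)
    moreover have "fps_eq_upto n (\<Prod>m\<in>A - {..n}. 1 + c * fps_X ^ m) 1"
      by (rule prod_eq_upto_1) auto
    ultimately show ?thesis
      using fps_eq_upto_mult[OF fps_eq_upto_refl] by fastforce
  qed
  show ?thesis
    using cut[OF assms(1)] fps_eq_upto_sym[OF cut[OF assms(2)]] fps_eq_upto_trans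
    unfolding assms(3) by blast
qed

section \<open>Gauss's identity for triangular exponents\<close>

definition minus_prod :: "nat \<Rightarrow> nat \<Rightarrow> real fps" where
  "minus_prod d n = (\<Prod>m=1..n. 1 - fps_X ^ (d * m))"

definition plus_prod :: "nat \<Rightarrow> nat \<Rightarrow> real fps" where
  "plus_prod d n = (\<Prod>m=1..n. 1 + fps_X ^ (d * m))"

lemma plus_prod_mult_minus_prod: "plus_prod d n * minus_prod d n = minus_prod (2 * d) n"
proof -
  have "(1 + fps_X ^ (d * m)) * (1 - fps_X ^ (d * m)) = (1 - fps_X ^ (2 * d * m) :: real fps)" for m
    by (simp add: algebra_simps flip: power_add)
  then show ?thesis
    unfolding plus_prod_def minus_prod_def prod.distrib[symmetric] by (simp only:)
qed

lemma fps_prod_nth_0: "prod f A $ 0 = (\<Prod>x\<in>A. f x $ 0)" for f :: "'b \<Rightarrow> 'a :: comm_ring_1 fps"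
  by (induction A rule: infinite_finite_induct) auto

lemma minus_prod_nth_0: "d > 0 \<Longrightarrow> minus_prod d n $ 0 \<noteq> 0"
  by (auto simp: minus_prod_def fps_prod_nth_0)

lemma plus_prod_nth_0: "d > 0 \<Longrightarrow> plus_prod d n $ 0 \<noteq> 0"
  by (auto simp: plus_prod_def fps_prod_nth_0)

lemma minus_prod_Suc: "minus_prod d (Suc n) = (1 - fps_X ^ (d * Suc n)) * minus_prod d n"
  by (simp add: minus_prod_def prod.nat_ivl_Suc' mult.commute del: mult_Suc_right)

definition triangle :: "nat \<Rightarrow> nat" where
  "triangle j = j * (j + 1) div 2"

lemma triangle_0 [simp]: "triangle 0 = 0"
  by (simp add: triangle_def)

lemma triangle_Suc [simp]: "triangle (Suc j) = triangle j + Suc j"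
  by (simp add: triangle_def)

lemma le_triangle: "j \<le> triangle j"
  by (induction j) auto

text \<open>
  The Gaussian binomial coefficient of \<open>2n+1\<close> over \<open>n-j\<close>, multiplied by the power with triangular
  exponent. The value 0 beyond \<open>n\<close> continues the convention for binomial coefficients and keeps
  the recurrence below free of boundary cases at the upper end.
\<close>

definition gauss_term :: "nat \<Rightarrow> nat \<Rightarrow> real fps" where
  "gauss_term n j = (if j \<le> n then
     fps_X ^ triangle j * minus_prod 1 (2 * n + 1) *
       (inverse (minus_prod 1 (n - j)) * inverse (minus_prod 1 (n + 1 + j))) else 0)"

lemma inverse_minus_prod:
  "inverse (minus_prod 1 n) = (1 - fps_X ^ Suc n) * inverse (minus_prod 1 (Suc n))"
proof -
  have inv: "minus_prod 1 n * inverse (minus_prod 1 n) = 1" for n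
    by (intro inverse_mult_eq_1' minus_prod_nth_0) simp
  have "minus_prod 1 n * ((1 - fps_X ^ Suc n) * inverse (minus_prod 1 (Suc n))) =
      minus_prod 1 (Suc n) * inverse (minus_prod 1 (Suc n))"
    unfolding minus_prod_Suc[of 1 n] nat_mult_1 by (simp only: mult_ac)
  then have "minus_prod 1 n * inverse (minus_prod 1 n) =
      minus_prod 1 n * ((1 - fps_X ^ Suc n) * inverse (minus_prod 1 (Suc n)))"
    by (simp only: inv)
  moreover have "minus_prod 1 n \<noteq> 0"
    using minus_prod_nth_0[of 1 n] by auto
  ultimately show ?thesis by simp
qed

text \<open>
  This is what two steps of the Pascal recurrence for Gaussian binomial coefficients give, one of
  each of its two forms. The triangular exponents make the outer terms have the same factor
  \<open>X^(n+1)\<close>. At \<open>j = 0\<close> the truncated subtraction is what the symmetry of the coefficients of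
  \<open>2n+1\<close> requires: the term with index \<open>-1\<close> equals the term with index 0.
\<close>

lemma gauss_term_Suc:
  "gauss_term (Suc n) j = fps_X ^ Suc n * gauss_term n (Suc j)
     + (1 + fps_X ^ (2 * Suc n)) * gauss_term n j + fps_X ^ Suc n * gauss_term n (j - 1)"
proof -
  consider "j > Suc n" | "j = Suc n" | "j \<le> n" by linarith
  then show ?thesis
  proof cases
    case 1
    then show ?thesis by (simp add: gauss_term_def)
  next
    case 2
    have "minus_prod 1 k * inverse (minus_prod 1 k) = 1" for k
      by (intro inverse_mult_eq_1' minus_prod_nth_0) simp
    moreover have "minus_prod 1 0 = 1" by (simp add: minus_prod_def)
    ultimately show ?thesis
      using 2 by (simp add: gauss_term_def mult.assoc power_add mult_2 del: mult_Suc_right)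
  next
    case 3
    \<comment> \<open>All terms are multiples of \<open>t * K\<close> with coefficients that are polynomials in \<open>q\<close>,
      \<open>x = q^(n-j)\<close> and \<open>y = q^j\<close>; the recurrence becomes an identity in these three variables.\<close>
    define i where "i = n - j"
    define t q x y :: "real fps" where
      "t = fps_X ^ triangle j" and "q = fps_X" and "x = fps_X ^ i" and "y = fps_X ^ j"
    define r where "r k = inverse (minus_prod 1 k)" for k
    define K where "K = minus_prod 1 (2 * n + 1) * (r (Suc i) * r (n + 2 + j))"
    have n: "n = i + j" using 3 by (simp add: i_def)
    have r_Suc: "r k = (1 - fps_X ^ Suc k) * r (Suc k)" for k
      unfolding r_def by (rule inverse_minus_prod)
    have lhs: "gauss_term (Suc n) j = t * ((1 - q^2 * x^2 * y^2) * (1 - q^3 * x^2 * y^2)) * K"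
    proof -
      have "minus_prod 1 (2 * Suc n + 1) =
          (1 - q^2 * x^2 * y^2) * (1 - q^3 * x^2 * y^2) * minus_prod 1 (2 * n + 1)"
        using minus_prod_Suc[of 1 "2 * n + 1"] minus_prod_Suc[of 1 "2 * n + 2"]
        by (simp add: q_def x_def y_def n power_add power_mult mult_ac power2_eq_square
              eval_nat_numeral)
      then show ?thesis
        using 3 by (simp add: gauss_term_def K_def r_def t_def i_def Suc_diff_le mult_ac)
    qed
    have next_term: "gauss_term n (Suc j) = t * (y * q * ((1 - x) * (1 - q * x))) * K"
    \<comment> \<open>For \<open>i = 0\<close> the term lies beyond the range, and the factor \<open>1 - x\<close> vanishes as well.\<close>
    proof (cases i)
      case 0
      then show ?thesis by (simp add: gauss_term_def n x_def)
    next
      case (Suc l)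
      have "gauss_term n (Suc j) = t * (y * q) * minus_prod 1 (2 * n + 1) * (r l * r (n + 2 + j))"
        using Suc by (simp add: gauss_term_def n r_def t_def y_def q_def power_add mult_ac)
      then show ?thesis
        using Suc r_Suc[of l] r_Suc[of "Suc l"]
        by (simp add: K_def x_def q_def mult_ac)
    qed
    have this_term: "gauss_term n j = t * ((1 - q * x) * (1 - q^2 * x * y^2)) * K"
    proof -
      have "gauss_term n j = t * minus_prod 1 (2 * n + 1) * (r i * r (n + 1 + j))"
        using 3 by (simp add: gauss_term_def r_def t_def i_def)
      moreover have "fps_X ^ Suc (n + 1 + j) = q^2 * x * y^2"
        by (simp add: n q_def x_def y_def power_add power2_eq_square mult_ac)
      ultimately show ?thesis
        using r_Suc[of i] r_Suc[of "n + 1 + j"]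
        by (simp add: K_def x_def q_def mult_ac)
    qed
    \<comment> \<open>The factor \<open>y\<close> makes up for the smaller triangular exponent; for \<open>j = 0\<close> it is 1, and the
      two inverses only change places.\<close>
    have prev_term: "y * gauss_term n (j - 1) = t * ((1 - q * x * y^2) * (1 - q^2 * x * y^2)) * K"
    proof -
      have "fps_X ^ Suc (n + 1 + j) = q^2 * x * y^2" "fps_X ^ Suc (n + j) = q * x * y^2"
        by (simp_all add: n q_def x_def y_def power_add power2_eq_square mult_ac)
      then have r: "r (n + j) = (1 - q * x * y^2) * ((1 - q^2 * x * y^2) * r (n + 2 + j))"
        using r_Suc[of "n + j"] r_Suc[of "n + 1 + j"] by simp
      have "y * gauss_term n (j - 1) = t * minus_prod 1 (2 * n + 1) * (r (Suc i) * r (n + j))"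
      proof (cases j)
        case 0
        have "r i * r (Suc i) = r (Suc i) * r i" by simp
        with 0 show ?thesis by (simp add: gauss_term_def r_def t_def n y_def)
      next
        case (Suc l)
        then show ?thesis
          by (simp add: gauss_term_def r_def t_def n y_def power_add mult_ac)
      qed
      then show ?thesis
        by (simp add: r K_def mult_ac)
    qed
    have ring_identity: "(1 - q^2 * x^2 * y^2) * (1 - q^3 * x^2 * y^2) =
        q * x * y * (y * q * ((1 - x) * (1 - q * x)))
        + (1 + q^2 * x^2 * y^2) * ((1 - q * x) * (1 - q^2 * x * y^2))
        + q * x * ((1 - q * x * y^2) * (1 - q^2 * x * y^2))"
      by algebra
    have "gauss_term (Suc n) j =
        q * x * y * gauss_term n (Suc j) + (1 + q^2 * x^2 * y^2) * gauss_term n j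
        + q * x * (y * gauss_term n (j - 1))"
      unfolding lhs next_term this_term prev_term ring_identity by algebra
    moreover have "fps_X ^ Suc n = q * x * y" "fps_X ^ (2 * Suc n) = q^2 * x^2 * y^2"
      by (simp_all add: n q_def x_def y_def power_add power_mult mult_ac power2_eq_square)
    ultimately show ?thesis by (simp add: mult_ac)
  qed
qed

text \<open>
  Summed over \<open>j\<close>, the outer terms of the recurrence are two shifts of the same sum. The first
  misses the term at 0 and the second has it twice, so the defects cancel and the sum is multiplied
  by \<open>1 + X^(2(n+1)) + 2 X^(n+1)\<close>, a square.
\<close>

lemma sum_gauss_term: "(\<Sum>j\<le>n. gauss_term n j) = plus_prod 1 n ^ 2"
proof (induction n)
  case 0
  have "minus_prod 1 1 * inverse (minus_prod 1 1) = 1"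
    by (intro inverse_mult_eq_1' minus_prod_nth_0) simp
  moreover have "minus_prod 1 0 = 1" by (simp add: minus_prod_def)
  ultimately show ?case
    by (simp add: gauss_term_def plus_prod_def)
next
  case (Suc n)
  let ?S = "\<Sum>j\<le>n. gauss_term n j" and ?q = "fps_X ^ Suc n :: real fps"
  have beyond: "gauss_term n j = 0" if "j > n" for j
    using that by (simp add: gauss_term_def)
  have "(\<Sum>j\<le>Suc n. gauss_term n (Suc j)) = ?S - gauss_term n 0"
    using sum.atMost_Suc_shift[of "gauss_term n" n] by (simp add: beyond)
  moreover have "(\<Sum>j\<le>Suc n. gauss_term n j) = ?S"
    by (simp add: beyond)
  moreover have "(\<Sum>j\<le>Suc n. gauss_term n (j - 1)) = gauss_term n 0 + ?S"
    by (subst sum.atMost_Suc_shift) simp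
  ultimately have "(\<Sum>j\<le>Suc n. gauss_term (Suc n) j) =
      ?q * (?S - gauss_term n 0) + (1 + fps_X ^ (2 * Suc n)) * ?S + ?q * (gauss_term n 0 + ?S)"
    by (simp only: gauss_term_Suc sum.distrib flip: sum_distrib_left)
  also have "fps_X ^ (2 * Suc n) = ?q ^ 2"
    by (simp only: power_mult mult.commute[of 2])
  also have "?q * (?S - gauss_term n 0) + (1 + ?q ^ 2) * ?S + ?q * (gauss_term n 0 + ?S) =
      (1 + ?q) ^ 2 * ?S"
    by algebra
  also have "\<dots> = plus_prod 1 (Suc n) ^ 2"
    unfolding Suc.IH by (simp add: plus_prod_def power_mult_distrib mult.commute)
  finally show ?case .
qed

text \<open>
  Each of the two quotients of products that arise consists of factors \<open>1 - X^m\<close> with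
  \<open>m > n - j\<close>, so it is 1 up to degree \<open>n - j\<close>. The missing degrees are supplied by the factor
  with triangular exponent, as this exponent is at least \<open>j\<close>.
\<close>

lemma minus_prod_mult_gauss_term:
  assumes "j \<le> n"
  shows "fps_eq_upto n (minus_prod 1 n * gauss_term n j) (fps_X ^ triangle j)"
proof -
  have ratio: "fps_eq_upto (n - j) (minus_prod 1 l * inverse (minus_prod 1 k)) 1"
    if "k \<le> l" "n - j \<le> k" for k l
  proof -
    have split: "{1..l} = {1..k} \<union> {k<..l}" using that by auto
    have "minus_prod 1 l = minus_prod 1 k * (\<Prod>m\<in>{k<..l}. 1 - fps_X ^ m)"
      unfolding minus_prod_def split by (subst prod.union_disjoint) auto
    moreover have "minus_prod 1 k * inverse (minus_prod 1 k) = 1"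
      by (intro inverse_mult_eq_1' minus_prod_nth_0) simp
    ultimately have "minus_prod 1 l * inverse (minus_prod 1 k) = (\<Prod>m\<in>{k<..l}. 1 - fps_X ^ m)"
      by (simp add: mult_ac)
    with prod_eq_upto_1[of "{k<..l}" "n - j" "- 1"] that show ?thesis by simp
  qed
  have "minus_prod 1 n * gauss_term n j = fps_X ^ triangle j *
      ((minus_prod 1 n * inverse (minus_prod 1 (n - j))) *
       (minus_prod 1 (2 * n + 1) * inverse (minus_prod 1 (n + 1 + j))))"
    using assms by (simp add: gauss_term_def mult_ac)
  moreover have "fps_eq_upto n \<dots> (fps_X ^ triangle j * (1 * 1))"
    using assms le_triangle[of j]
    by (intro fps_eq_upto_X_power_mult[where k = "n - j"] fps_eq_upto_mult ratio) auto
  ultimately show ?thesis by (simp only: mult_1_right)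
qed

lemma gauss_triangular:
  "fps_eq_upto n (\<Sum>j\<le>n. fps_X ^ triangle j) (plus_prod 1 n * minus_prod 2 n)"
proof -
  have "plus_prod 1 n * minus_prod 2 n = minus_prod 1 n * (\<Sum>j\<le>n. gauss_term n j)"
    using plus_prod_mult_minus_prod[of 1 n]
    by (simp add: sum_gauss_term power2_eq_square mult_ac)
  also have "\<dots> = (\<Sum>j\<le>n. minus_prod 1 n * gauss_term n j)"
    by (rule sum_distrib_left)
  also have "fps_eq_upto n \<dots> (\<Sum>j\<le>n. fps_X ^ triangle j)"
    by (intro fps_eq_upto_sum minus_prod_mult_gauss_term) simp
  finally show ?thesis by (rule fps_eq_upto_sym)
qed

section \<open>The generating functions\<close>

lemma part_series_at_most_once:
  assumes "m > 0"
  shows "part_series m (\<lambda>c. if c \<le> 1 then 1 else 0) = (1 + fps_X ^ m :: 'a :: comm_ring_1 fps)"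
proof (rule fps_ext)
  fix i
  show "part_series m (\<lambda>c. if c \<le> 1 then 1 else 0) $ i = (1 + fps_X ^ m :: 'a fps) $ i"
    using assms by (cases "i = 0"; cases "m dvd i") (auto simp: part_series_def elim!: dvdE)
qed

lemma part_series_absent: "m > 0 \<Longrightarrow> part_series m (\<lambda>c. if c = 0 then 1 else 0) = 1"
  by (rule fps_ext) (auto simp: part_series_def elim!: dvdE)

text \<open>
  With \<open>a = 1\<close> this is the geometric series, with \<open>a = 2\<close> the factor \<open>(1 + X^m) / (1 - X^m)\<close> of
  overpartitions.
\<close>

lemma part_series_geometric:
  fixes a :: "'a :: comm_ring_1"
  assumes "m > 0"
  shows "part_series m (\<lambda>c. if c = 0 then 1 else a) * (1 - fps_X ^ m) =
    1 + fps_const (a - 1) * fps_X ^ m"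
proof (rule fps_ext)
  fix i
  let ?f = "part_series m (\<lambda>c. if c = 0 then 1 else a)"
  have lhs: "(?f * (1 - fps_X ^ m)) $ i = ?f $ i - (if i < m then 0 else ?f $ (i - m))"
    by (simp add: right_diff_distrib fps_X_power_mult_right_nth)
  show "(?f * (1 - fps_X ^ m)) $ i = (1 + fps_const (a - 1) * fps_X ^ m) $ i"
  proof (cases "m dvd i")
    case False
    then show ?thesis
      unfolding lhs using dvd_diffD[of m i m] by (cases "i = 0") (auto simp: part_series_def)
  next
    case True
    then obtain c where c: "i = m * c" by (rule dvdE)
    consider "c = 0" | "c = 1" | l where "c = Suc (Suc l)"
      by (metis One_nat_def not0_implies_Suc)
    then show ?thesis
      unfolding lhs using c assms by cases (auto simp: part_series_def)
  qed
qed

lemma distinct_iff_count_list: "distinct xs \<longleftrightarrow> (\<forall>x. count_list xs x \<le> 1)"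
proof (induction xs)
  case (Cons a xs)
  then show ?case
    by (auto simp: count_list_0_iff[symmetric] le_Suc_eq split: if_splits)
qed simp

lemma card_partitions_eq_coeff:
  assumes "\<And>xs. xs \<in> partitions n \<Longrightarrow> P xs \<longleftrightarrow> (\<forall>m\<in>{1..n}. A m (count_list xs m))"
  shows "real (card {xs \<in> partitions n. P xs}) =
    (\<Prod>m=1..n. part_series m (\<lambda>c. if A m c then 1 else 0)) $ n"
proof -
  have "real (card {xs \<in> partitions n. P xs}) = (\<Sum>xs\<in>partitions n. if P xs then 1 else 0)"
    by (simp add: finite_partitions sum.If_cases Int_def)
  also have "\<dots> = (\<Sum>xs\<in>partitions n. \<Prod>m=1..n. if A m (count_list xs m) then 1 else 0)"
    using assms by (intro sum.cong) (auto intro!: prod_zero[symmetric])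
  finally show ?thesis
    by (simp only: sum_partitions_upto_eq_coeff[where w = "\<lambda>m c. if A m c then 1 else 0", symmetric]
          partitions_upto_eq_partitions[OF order_refl])
qed

lemma Q2_eq_coeff: "real (Q2 n) = (\<Prod>m | m \<in> {1..n} \<and> m mod 4 \<noteq> 2. 1 + fps_X ^ m) $ n"
proof -
  let ?A = "\<lambda>m c :: nat. (m mod 4 = 2 \<longrightarrow> c = 0) \<and> c \<le> 1"
  have "distinct xs \<and> (\<forall>x\<in>set xs. x mod 4 \<noteq> 2) \<longleftrightarrow> (\<forall>m\<in>{1..n}. ?A m (count_list xs m))"
    if "xs \<in> partitions n" for xs
  proof -
    have "set xs \<subseteq> {1..n}"
      using that partitions_upto_eq_partitions[of n n] by (auto simp: partitions_upto_def)
    then have "count_list xs m = 0" if "m \<notin> {1..n}" for m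
      using that by (intro count_notin) blast
    then have "(\<forall>m\<in>{1..n}. ?A m (count_list xs m)) \<longleftrightarrow> (\<forall>m. ?A m (count_list xs m))"
      by (metis le0)
    also have "\<dots> \<longleftrightarrow> distinct xs \<and> (\<forall>x\<in>set xs. x mod 4 \<noteq> 2)"
      unfolding distinct_iff_count_list count_list_0_iff by blast
    finally show ?thesis ..
  qed
  from card_partitions_eq_coeff[where A = ?A, OF this]
  have "real (Q2 n) = (\<Prod>m=1..n. part_series m (\<lambda>c. if ?A m c then 1 else 0)) $ n"
    by (simp add: Q2_def)
  also have "(\<Prod>m=1..n. part_series m (\<lambda>c. if ?A m c then 1 else 0)) =
      (\<Prod>m=1..n. if m mod 4 \<noteq> 2 then 1 + fps_X ^ m else (1 :: real fps))"
    by (intro prod.cong refl) (simp add: part_series_absent part_series_at_most_once[simplified] cong: conj_cong)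
  also have "\<dots> = (\<Prod>m | m \<in> {1..n} \<and> m mod 4 \<noteq> 2. 1 + fps_X ^ m)"
    by (rule prod.inter_filter[symmetric]) simp
  finally show ?thesis .
qed

lemma b4_eq_coeff:
  obtains B :: "real fps"
  where "real (b4 n) = B $ n" and "B * (\<Prod>m | m \<in> {1..n} \<and> \<not> 4 dvd m. 1 - fps_X ^ m) = 1"
proof
  let ?A = "\<lambda>m c :: nat. c = 0 \<or> \<not> 4 dvd m"
  let ?B = "\<Prod>m=1..n. part_series m (\<lambda>c. if ?A m c then 1 else 0) :: real fps"
  have "(\<forall>x\<in>set xs. \<not> 4 dvd x) \<longleftrightarrow> (\<forall>m\<in>{1..n}. ?A m (count_list xs m))"
    if "xs \<in> partitions n" for xs
    using that partitions_upto_eq_partitions[of n n]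
    by (auto simp: partitions_upto_def count_list_0_iff)
  from card_partitions_eq_coeff[where A = ?A, OF this] show "real (b4 n) = ?B $ n"
    by (simp add: b4_def)
  have "part_series m (\<lambda>c. if ?A m c then 1 else 0) * (if \<not> 4 dvd m then 1 - fps_X ^ m else 1)
      = (1 :: real fps)" if "m \<in> {1..n}" for m
    using that part_series_geometric[of m "1 :: real"] part_series_absent[of m, where ?'a = real]
    by auto
  then show "?B * (\<Prod>m | m \<in> {1..n} \<and> \<not> 4 dvd m. 1 - fps_X ^ m) = 1"
    by (subst prod.inter_filter) (simp_all flip: prod.distrib)
qed

definition overpartition_series :: "nat \<Rightarrow> real fps" where
  "overpartition_series M = (\<Prod>m=1..M. part_series m (\<lambda>c. if c = 0 then 1 else 2))"

lemma overpartition_series_nth: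
  assumes "j \<le> M"
  shows "overpartition_series M $ j = real (card (overpartitions j))"
proof -
  have "overpartition_series M $ j =
      (\<Sum>xs\<in>partitions j. \<Prod>m=1..M. if count_list xs m = 0 then 1 else 2)"
    unfolding overpartition_series_def partitions_upto_eq_partitions[OF assms, symmetric]
    by (rule sum_partitions_upto_eq_coeff[symmetric])
  also have "\<dots> = (\<Sum>xs\<in>partitions j. 2 ^ card (set xs))"
  proof (intro sum.cong refl)
    fix xs assume "xs \<in> partitions j"
    then have "set xs \<subseteq> {1..M}"
      using partitions_upto_eq_partitions[OF assms] by (auto simp: partitions_upto_def)
    then have eq: "{1..M} \<inter> - {m. m \<notin> set xs} = set xs" by auto
    show "(\<Prod>m=1..M. if count_list xs m = 0 then 1 else 2) = (2 :: real) ^ card (set xs)"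
      by (simp add: count_list_0_iff prod.If_cases eq[simplified])
  qed
  finally show ?thesis by (simp add: card_overpartitions)
qed

lemma overpartition_series_mult_minus_prod:
  assumes "d > 0"
  shows "(overpartition_series M oo fps_X ^ d) * minus_prod d M = plus_prod d M"
proof -
  have d: "(fps_X ^ d :: real fps) $ 0 = 0" using assms by simp
  have X: "(fps_X ^ m oo fps_X ^ d) = (fps_X ^ (d * m) :: real fps)" for m
    by (simp add: fps_compose_power[OF d, symmetric] fps_X_fps_compose_startby0[OF d] power_mult)
  have "overpartition_series M * minus_prod 1 M = plus_prod 1 M"
    unfolding overpartition_series_def minus_prod_def plus_prod_def prod.distrib[symmetric]
    by (intro prod.cong refl) (simp add: part_series_geometric)
  then have "(overpartition_series M oo fps_X ^ d) * (minus_prod 1 M oo fps_X ^ d) =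
      plus_prod 1 M oo fps_X ^ d"
    by (simp flip: fps_compose_mult_distrib[OF d])
  moreover have "minus_prod 1 M oo fps_X ^ d = minus_prod d M"
    by (simp add: minus_prod_def fps_compose_prod_distrib[OF d] fps_compose_sub_distrib X)
  moreover have "plus_prod 1 M oo fps_X ^ d = plus_prod d M"
    by (simp add: plus_prod_def fps_compose_prod_distrib[OF d] fps_compose_add_distrib X)
  ultimately show ?thesis by simp
qed

section \<open>Comparing the products\<close>

lemma prod_multiples:
  fixes d :: nat
  assumes "d > 0"
  shows "(\<Prod>m=1..n. f (d * m)) = (\<Prod>m\<in>(\<lambda>m. d * m) ` {1..n}. f m)"
  using assms by (simp add: prod.reindex inj_on_def)

text \<open>
  An even number is either 2 modulo 4 or a multiple of 4.
\<close>

lemma prod_2_mod_4_mult_plus_prod_4: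
  "fps_eq_upto n ((\<Prod>m | m \<in> {1..n} \<and> m mod 4 = 2. 1 + fps_X ^ m) * plus_prod 4 n) (plus_prod 2 n)"
proof -
  let ?A = "{m \<in> {1..n}. m mod 4 = 2}" and ?B = "(\<lambda>m. 4 * m) ` {1..n}"
  have "(\<Prod>m\<in>?A. 1 + fps_X ^ m) * plus_prod 4 n = (\<Prod>m\<in>?A \<union> ?B. 1 + fps_X ^ m)"
    unfolding plus_prod_def prod_multiples[of 4 "\<lambda>m. 1 + fps_X ^ m" n, OF zero_less_numeral]
    by (intro prod.union_disjoint[symmetric]) auto
  moreover have "plus_prod 2 n = (\<Prod>m\<in>(\<lambda>m. 2 * m) ` {1..n}. 1 + fps_X ^ m)"
    unfolding plus_prod_def by (rule prod_multiples) simp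
  moreover have "(?A \<union> ?B) \<inter> {..n} = (\<lambda>m. 2 * m) ` {1..n} \<inter> {..n}"
  proof -
    have "m \<in> ?A \<union> ?B \<longleftrightarrow> m \<in> (\<lambda>m. 2 * m) ` {1..n}" if "m \<le> n" for m
    proof -
      have "m \<in> ?B \<longleftrightarrow> m > 0 \<and> 4 dvd m"
        using that by (auto simp: image_iff elim!: dvdE)
      moreover have "m \<in> (\<lambda>m. 2 * m) ` {1..n} \<longleftrightarrow> m > 0 \<and> 2 dvd m"
        using that by (auto simp: image_iff elim!: dvdE)
      moreover have "2 dvd m \<longleftrightarrow> 4 dvd m \<or> m mod 4 = 2" by presburger
      moreover have "m mod 4 = 2 \<Longrightarrow> m > 0" by (cases m) auto
      ultimately show ?thesis using that by auto
    qed
    then show ?thesis by blast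
  qed
  ultimately show ?thesis
    using prod_eq_upto[of "?A \<union> ?B" "(\<lambda>m. 2 * m) ` {1..n}" n 1] by simp
qed

lemma prod_not_4_dvd_mult_minus_prod_4:
  "fps_eq_upto n ((\<Prod>m | m \<in> {1..n} \<and> \<not> 4 dvd m. 1 - fps_X ^ m) * minus_prod 4 n) (minus_prod 1 n)"
proof -
  let ?A = "{m \<in> {1..n}. \<not> 4 dvd m}" and ?B = "(\<lambda>m. 4 * m) ` {1..n}"
  have "(\<Prod>m\<in>?A. 1 - fps_X ^ m) * minus_prod 4 n = (\<Prod>m\<in>?A \<union> ?B. 1 - fps_X ^ m)"
    unfolding minus_prod_def prod_multiples[of 4 "\<lambda>m. 1 - fps_X ^ m" n, OF zero_less_numeral]
    by (intro prod.union_disjoint[symmetric]) auto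
  moreover have "(?A \<union> ?B) \<inter> {..n} = {1..n} \<inter> {..n}"
    by (auto simp: image_iff elim!: dvdE)
  ultimately show ?thesis
    using prod_eq_upto[of "?A \<union> ?B" "{1..n}" n "- 1"] by (simp add: minus_prod_def)
qed

text \<open>
  In the notation of the introduction, both sides are multiplied by the denominators \<open>P\<^sub>2\<close> and
  \<open>E\<^sub>4\<close>, where \<open>P\<^sub>2\<close> is written as \<open>P\<^sub>4\<close> times the factors with \<open>m\<close> congruent to 2 modulo 4;
  it remains to use \<open>\<psi> = P\<^sub>1 E\<^sub>2\<close> and \<open>P\<^sub>2 E\<^sub>2 = E\<^sub>4\<close>.
\<close>

lemma Q2_series_factors:
  "fps_eq_upto n (\<Prod>m | m \<in> {1..n} \<and> m mod 4 \<noteq> 2. 1 + fps_X ^ m)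
     ((\<Sum>j\<le>n. fps_X ^ triangle j) * (overpartition_series n oo fps_X ^ 4))"
    (is "fps_eq_upto n ?Q (?psi * ?G)")
proof (rule fps_eq_upto_cancel)
  let ?O = "\<Prod>m | m \<in> {1..n} \<and> m mod 4 = 2. 1 + fps_X ^ m :: real fps"
  let ?h = "?O * plus_prod 4 n * minus_prod 4 n"
  have "?O * ?Q = (\<Prod>m\<in>{m \<in> {1..n}. m mod 4 = 2} \<union> {m \<in> {1..n}. m mod 4 \<noteq> 2}. 1 + fps_X ^ m)"
    by (rule prod.union_disjoint[symmetric]) auto
  also have "\<dots> = plus_prod 1 n"
    unfolding plus_prod_def by (intro prod.cong) auto
  finally have Q: "?O * ?Q = plus_prod 1 n" .
  have "?h * (?psi * ?G) = ?psi * plus_prod 4 n * (?O * plus_prod 4 n)"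
    using overpartition_series_mult_minus_prod[of 4 n] by (simp add: mult_ac)
  also have "fps_eq_upto n \<dots> (plus_prod 1 n * minus_prod 2 n * plus_prod 4 n * plus_prod 2 n)"
    by (intro fps_eq_upto_mult gauss_triangular prod_2_mod_4_mult_plus_prod_4 fps_eq_upto_refl)
  also have "\<dots> = plus_prod 1 n * plus_prod 4 n * minus_prod 4 n"
    using plus_prod_mult_minus_prod[of 2 n] by (simp add: mult_ac)
  also have "\<dots> = ?h * ?Q"
    by (simp only: Q[symmetric] mult_ac)
  finally show "fps_eq_upto n (?h * ?Q) (?h * (?psi * ?G))"
    by (rule fps_eq_upto_sym)
  show "?h $ 0 \<noteq> 0"
    using plus_prod_nth_0[of 4 n] minus_prod_nth_0[of 4 n] by (auto simp: fps_prod_nth_0)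
qed

text \<open>
  In the notation of the introduction, both sides are multiplied by \<open>E\<^sub>1\<close> and \<open>E\<^sub>2\<close>, where \<open>E\<^sub>1\<close>
  is written as \<open>E\<^sub>4\<close> times the factors with \<open>m\<close> not divisible by 4; the claim becomes
  \<open>(P\<^sub>1 E\<^sub>1) (P\<^sub>2 E\<^sub>2) = E\<^sub>2 E\<^sub>4\<close>.
\<close>

lemma b4_series_factors:
  assumes "B * (\<Prod>m | m \<in> {1..n} \<and> \<not> 4 dvd m. 1 - fps_X ^ m) = 1"
  shows "fps_eq_upto n B
     ((\<Sum>j\<le>n. fps_X ^ triangle j) * (overpartition_series n oo fps_X ^ 2))"
    (is "fps_eq_upto n B (?psi * ?G)")
proof (rule fps_eq_upto_cancel)
  let ?D = "\<Prod>m | m \<in> {1..n} \<and> \<not> 4 dvd m. 1 - fps_X ^ m :: real fps"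
  let ?h = "?D * minus_prod 4 n * minus_prod 2 n"
  have "?h * (?psi * ?G) = ?psi * plus_prod 2 n * (?D * minus_prod 4 n)"
    using overpartition_series_mult_minus_prod[of 2 n] by (simp add: mult_ac)
  also have "fps_eq_upto n \<dots> (plus_prod 1 n * minus_prod 2 n * plus_prod 2 n * minus_prod 1 n)"
    by (intro fps_eq_upto_mult gauss_triangular prod_not_4_dvd_mult_minus_prod_4 fps_eq_upto_refl)
  also have "\<dots> = (plus_prod 1 n * minus_prod 1 n) * (plus_prod 2 n * minus_prod 2 n)"
    by (simp only: mult_ac)
  also have "\<dots> = minus_prod 2 n * minus_prod 4 n"
    by (simp add: plus_prod_mult_minus_prod)
  also have "\<dots> = (B * ?D) * (minus_prod 2 n * minus_prod 4 n)"
    by (simp only: assms mult_1_left)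
  also have "\<dots> = ?h * B"
    by (simp only: mult_ac)
  finally show "fps_eq_upto n (?h * B) (?h * (?psi * ?G))"
    by (rule fps_eq_upto_sym)
  show "?h $ 0 \<noteq> 0"
    using minus_prod_nth_0[of 2 n] minus_prod_nth_0[of 4 n] by (auto simp: fps_prod_nth_0)
qed

section \<open>Reading off coefficients\<close>

lemma pbar_nat_quotient:
  assumes "d > 0"
  shows "pbar ((of_nat n - of_nat k * (of_nat k + 1) / 2) / of_nat d) =
    (if triangle k \<le> n \<and> d dvd n - triangle k
     then card (overpartitions ((n - triangle k) div d)) else 0)"
proof -
  let ?x = "(of_nat n - of_nat k * (of_nat k + 1) / 2) / of_nat d :: rat"
  have "2 * triangle k = k * (k + 1)" by (simp add: triangle_def)
  then have "2 * of_nat (triangle k) = (of_nat k * (of_nat k + 1) :: rat)"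
    by (metis of_nat_1 of_nat_add of_nat_mult of_nat_numeral)
  then have x: "?x = (of_nat n - of_nat (triangle k)) / of_nat d" by simp
  have eq: "?x = of_nat j \<longleftrightarrow> n = triangle k + d * j" for j
  proof -
    have "?x = of_nat j \<longleftrightarrow> (of_nat n :: rat) = of_nat (triangle k + d * j)"
      unfolding x using assms by (auto simp: field_simps)
    then show ?thesis by (simp only: of_nat_eq_iff)
  qed
  show ?thesis
  proof (cases "triangle k \<le> n \<and> d dvd n - triangle k")
    case True
    then obtain j where "n - triangle k = d * j" by (auto elim: dvdE)
    with True have "n = triangle k + d * j" by simp
    with eq[of j] assms show ?thesis by (simp add: pbar_def del: of_nat_mult)
  next
    case False
    then have "?x \<noteq> of_nat j" for j unfolding eq by auto
    then have "?x \<notin> \<nat>" by (auto elim: Nats_cases)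
    with False show ?thesis by (auto simp: pbar_def)
  qed
qed

lemma pbar_sums_coeff:
  assumes "d > 0" and "real a = F $ n"
    and "fps_eq_upto n F
      ((\<Sum>j\<le>n. fps_X ^ triangle j) * (overpartition_series n oo fps_X ^ d))"
  shows "(\<lambda>k. pbar ((of_nat n - of_nat k * (of_nat k + 1) / 2) / of_nat d)) sums a"
proof -
  let ?p = "\<lambda>k. pbar ((of_nat n - of_nat k * (of_nat k + 1) / 2) / of_nat d)"
  let ?G = "overpartition_series n oo fps_X ^ d"
  have G: "?G $ i = (if d dvd i then real (card (overpartitions (i div d))) else 0)" if "i \<le> n" for i
  proof -
    have "i div d \<le> n" using that div_le_dividend order_trans by blast
    then show ?thesis by (simp add: fps_nth_compose_X_power assms(1) overpartition_series_nth)
  qed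
  have "real a = ((\<Sum>k\<le>n. fps_X ^ triangle k) * ?G) $ n"
    using assms(2,3) by (simp add: fps_eq_upto_def)
  also have "\<dots> = (\<Sum>k\<le>n. if n < triangle k then 0 else ?G $ (n - triangle k))"
    by (simp add: sum_distrib_right fps_sum_nth fps_X_power_mult_nth)
  also have "\<dots> = (\<Sum>k\<le>n. real (?p k))"
    by (intro sum.cong refl) (auto simp: pbar_nat_quotient[OF assms(1)] G)
  finally have "a = (\<Sum>k\<le>n. ?p k)"
    by (simp flip: of_nat_sum)
  moreover have "?p k = 0" if "k \<notin> {..n}" for k
    using that le_triangle[of k] by (simp add: pbar_nat_quotient[OF assms(1)])
  ultimately show ?thesis
    using sums_finite[of "{..n}" ?p] by simp
qed

theorem theorem6p2:
  fixes n :: nat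
  shows "(\<lambda>k::nat. pbar ((of_nat n - of_nat k * (of_nat k + 1) / 2) / 4)) sums Q2 n \<and>
         (\<lambda>k::nat. pbar ((of_nat n - of_nat k * (of_nat k + 1) / 2) / 2)) sums b4 n"
proof
  show "(\<lambda>k::nat. pbar ((of_nat n - of_nat k * (of_nat k + 1) / 2) / 4)) sums Q2 n"
    using pbar_sums_coeff[OF _ Q2_eq_coeff Q2_series_factors] by simp
  obtain B where B: "real (b4 n) = B $ n"
      "B * (\<Prod>m | m \<in> {1..n} \<and> \<not> 4 dvd m. 1 - fps_X ^ m) = 1"
    by (rule b4_eq_coeff)
  show "(\<lambda>k::nat. pbar ((of_nat n - of_nat k * (of_nat k + 1) / 2) / 2)) sums b4 n"
    using pbar_sums_coeff[OF _ B(1) b4_series_factors[OF B(2)]] by simp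
qed

end
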